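(* Let $W$ be a Weyl tensor of Petrov type I, with (three distinct) eigenvalues $\rho_1,\rho_2,\rho_3$ and orthonormal frame $\{\mathcal U_i\}$ of self-dual eigenbivectors, so that $\mathcal W=-\sum_{i=1}^3\rho_i\,\mathcal U_i\otimes\mathcal U_i$. Then its Bel-Robinson tensor $T$ admits the canonical expression $$T=\sum_{i=1}^3t_i\,\Pi_i\otimes\Pi_i+\sum_{(ijk)}\tau_i\,\Pi_{jk}\otimes\Pi_{jk}+\sum_{(ijk)}\overline{\tau}_i\,\Pi_{kj}\otimes\Pi_{kj},$$ where the sums $\sum_{(ijk)}$ run over the even permutations $(i,j,k)$ of $(1,2,3)$, $t_i=|\rho_i|^2$, $\tau_i=\rho_j\overline{\rho}_k$ for $(i,j,k)$ an even permutation, $\Pi_i=\mathcal U_i\cdot\overline{\mathcal U}_i$ are eigentensors of $T$ associated with the real eigenvalues $t_i$, and $\Pi_{jk}=\mathcal U_j\cdot\overline{\mathcal U}_k\ (=\overline{\Pi}_{kj})$ are eigentensors associated with the (generically) complex eigenvalues $\tau_i$, $(i,j,k)$ being an even permutation of $(1,2,3)$.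
   Context: $(V,g)$ is an oriented 4-dimensional real vector space with a Lorentzian metric of signature $(-,+,+,+)$ (the tangent space of a space-time at a point); indices are moved with $g$; $\eta$ is the metric volume element; $( *F)_{\alpha\beta}=\frac12\eta_{\alpha\beta\mu\nu}F^{\mu\nu}$, $( *W)_{\alpha\beta\mu\nu}=\frac12\eta_{\alpha\beta}{}^{\rho\sigma}W_{\rho\sigma\mu\nu}$. A self-dual (SD) bivector is a complex 2-form $\mathcal F$ with $*\mathcal F=\mathrm i\mathcal F$; these form a complex 3-dimensional space with metric $\mathcal G(\mathcal F,\mathcal H)=\frac12\mathcal F_{\alpha\beta}\mathcal H^{\alpha\beta}$. A frame $\{\mathcal U_i\}_{i=1,2,3}$ of SD bivectors is orthonormal if $\mathcal G(\mathcal U_i,\mathcal U_j)=-\delta_{ij}$. A Weyl tensor $W$ is a real 4-tensor with the algebraic symmetries of a Riemann tensor and vanishing traces; $\mathcal W=\frac12(W-\mathrm i*W)$ acts on SD bivectors by $\mathcal W(\mathcal F)_{\alpha\beta}=\frac12\mathcal W_{\alpha\beta}{}^{\mu\nu}\mathcal F_{\mu\nu}$, and its eigenvalues are called the eigenvalues of $W$ (their sum is zero). $W$ is of type I if the three eigenvalues are distinct. The Bel-Robinson (BR) tensor of $W$ is $T_{\alpha\mu\beta\nu}=\mathcal W_{\alpha}{}^{\rho}{}_{\beta}{}^{\sigma}\,\overline{\mathcal W}_{\mu\rho\nu\sigma}$; it is totally symmetric and traceless and acts on the (complexified) 9-dimensional space of traceless symmetric 2-tensors by $T(A)_{\alpha\beta}=T_{\alpha\beta}{}^{\mu\nu}A_{\mu\nu}$;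 an eigentensor is an eigenvector of this map. For 2-tensors $(A\cdot B)_{\alpha\beta}=A_{\alpha}{}^{\mu}B_{\mu\beta}$. *)

theory Defs
  imports "HOL-Analysis.Analysis"
begin

section \<open>Four-dimensional Lorentzian vector spaces\<close>

text \<open>
  Covariant tensors are multilinear functions of vectors.  The frame index \<open>0\<close> (which is the same
  element of the four-element index type as \<open>4\<close>) is the timelike one.
\<close>

definition lorentz_sign :: "4 \<Rightarrow> real" where
  "lorentz_sign i = (if i = 0 then -1 else 1)"

definition orthonormal_basis :: "('v::real_vector \<Rightarrow> 'v \<Rightarrow> real) \<Rightarrow> (4 \<Rightarrow> 'v) \<Rightarrow> bool" where
  "orthonormal_basis g e \<longleftrightarrow>
     span (range e) = UNIV \<and>
     (\<forall>i j. g (e i) (e j) = (if i = j then lorentz_sign i else 0))"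

definition lorentzian_metric :: "('v::real_vector \<Rightarrow> 'v \<Rightarrow> real) \<Rightarrow> bool" where
  "lorentzian_metric g \<longleftrightarrow>
     bilinear g \<and> (\<forall>x y. g x y = g y x) \<and> (\<exists>e. orthonormal_basis g e)"

text \<open>
  \<open>contract g f\<close> is the metric trace of a bilinear \<open>f\<close>, that is \<open>f\<close> with its two indices contracted
  by means of the inverse metric.  The lemma \<open>contract_eq\<close> below shows that the choice of the
  orthonormal basis is immaterial.
\<close>

definition contract :: "('v::real_vector \<Rightarrow> 'v \<Rightarrow> real) \<Rightarrow> ('v \<Rightarrow> 'v \<Rightarrow> 'a::real_vector) \<Rightarrow> 'a" where
  "contract g f =
     (let e = (SOME e. orthonormal_basis g e)
      in \<Sum>i\<in>UNIV. lorentz_sign i *\<^sub>R f (e i) (e i))"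

lemma orthonormal_expansion:
  assumes g: "bilinear g" and e: "orthonormal_basis g e"
  shows "x = (\<Sum>i\<in>UNIV. (lorentz_sign i * g x (e i)) *\<^sub>R e i)"
proof -
  have "x \<in> span (range e)"
    using e by (simp add: orthonormal_basis_def)
  then show ?thesis
  proof (induction rule: span_induct_alt)
    case base
    then show ?case by (simp add: bilinear_lzero[OF g])
  next
    case (step c b y)
    then obtain k where k: "b = e k" by auto
    have gek: "lorentz_sign i * g (e k) (e i) = (if i = k then 1 else 0)" for i
      using e by (auto simp: orthonormal_basis_def lorentz_sign_def)
    have "(\<Sum>i\<in>UNIV. (lorentz_sign i * g (c *\<^sub>R b + y) (e i)) *\<^sub>R e i)
        = (\<Sum>i\<in>UNIV. (c * (lorentz_sign i * g (e k) (e i))) *\<^sub>R e i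
                     + (lorentz_sign i * g y (e i)) *\<^sub>R e i)"
      by (intro sum.cong) (auto simp: k bilinear_ladd[OF g] bilinear_lmul[OF g] algebra_simps)
    also have "\<dots> = (\<Sum>i\<in>UNIV. (if i = k then c *\<^sub>R e i else 0))
                    + (\<Sum>i\<in>UNIV. (lorentz_sign i * g y (e i)) *\<^sub>R e i)"
      unfolding sum.distrib gek by (intro arg_cong2[where f = "(+)"] sum.cong) auto
    also have "\<dots> = c *\<^sub>R b + y"
      using step by (simp add: k)
    finally show ?case by simp
  qed
qed

lemma contract_eq:
  assumes g: "lorentzian_metric g" and f: "bilinear f" and e: "orthonormal_basis g e"
  shows "contract g f = (\<Sum>i\<in>UNIV. lorentz_sign i *\<^sub>R f (e i) (e i))"
proof -
  define d where "d = (SOME e. orthonormal_basis g e)"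
  have d: "orthonormal_basis g d"
    unfolding d_def using e by (rule someI[where P = "orthonormal_basis g"])
  have bil: "bilinear g" and sym: "\<And>x y. g x y = g y x"
    using g by (auto simp: lorentzian_metric_def)
  have lin1: "linear (\<lambda>x. f x y)" and lin2: "linear (f x)" for x y
    using f by (auto simp: bilinear_def)
  have "contract g f = (\<Sum>j\<in>UNIV. lorentz_sign j *\<^sub>R f (d j) (d j))"
    by (simp add: contract_def d_def Let_def)
  also have "\<dots> = (\<Sum>j\<in>UNIV. lorentz_sign j *\<^sub>R
      f (\<Sum>i\<in>UNIV. (lorentz_sign i * g (d j) (e i)) *\<^sub>R e i) (d j))"
    using orthonormal_expansion[OF bil e] by simp
  also have "\<dots> = (\<Sum>j\<in>UNIV. \<Sum>i\<in>UNIV.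
      (lorentz_sign j * lorentz_sign i * g (d j) (e i)) *\<^sub>R f (e i) (d j))"
    by (simp add: linear_sum[OF lin1] linear_scale[OF lin1] scaleR_sum_right mult.assoc)
  also have "\<dots> = (\<Sum>i\<in>UNIV. \<Sum>j\<in>UNIV.
      (lorentz_sign j * lorentz_sign i * g (d j) (e i)) *\<^sub>R f (e i) (d j))"
    by (rule sum.swap)
  also have "\<dots> = (\<Sum>i\<in>UNIV. lorentz_sign i *\<^sub>R
      f (e i) (\<Sum>j\<in>UNIV. (lorentz_sign j * g (e i) (d j)) *\<^sub>R d j))"
    by (simp add: linear_sum[OF lin2] linear_scale[OF lin2] scaleR_sum_right sym mult_ac)
  also have "\<dots> = (\<Sum>i\<in>UNIV. lorentz_sign i *\<^sub>R f (e i) (e i))"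
    using orthonormal_expansion[OF bil d] by simp
  finally show ?thesis .
qed

definition multilinear4 :: "('v::real_vector \<Rightarrow> 'v \<Rightarrow> 'v \<Rightarrow> 'v \<Rightarrow> 'a::real_vector) \<Rightarrow> bool" where
  "multilinear4 S \<longleftrightarrow>
     (\<forall>y z w. linear (\<lambda>x. S x y z w)) \<and> (\<forall>x z w. linear (\<lambda>y. S x y z w)) \<and>
     (\<forall>x y w. linear (\<lambda>z. S x y z w)) \<and> (\<forall>x y z. linear (\<lambda>w. S x y z w))"

text \<open>
  A metric volume element takes the values \<open>\<plusminus>1\<close> on orthonormal bases, so there are exactly two of
  them; giving one amounts to giving an orientation (the one for which the basis \<open>e\<close> below is
  positively oriented).
\<close>

definition volume_element ::
  "('v::real_vector \<Rightarrow> 'v \<Rightarrow> real) \<Rightarrow> ('v \<Rightarrow> 'v \<Rightarrow> 'v \<Rightarrow> 'v \<Rightarrow> real) \<Rightarrow> bool" where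
  "volume_element g \<eta> \<longleftrightarrow>
     multilinear4 \<eta> \<and>
     (\<forall>x y z w. \<eta> y x z w = - \<eta> x y z w \<and> \<eta> x z y w = - \<eta> x y z w \<and> \<eta> x y w z = - \<eta> x y z w) \<and>
     (\<exists>e. orthonormal_basis g e \<and> \<eta> (e 0) (e 1) (e 2) (e 3) = 1)"

section \<open>Two-tensors and self-dual bivectors\<close>

definition tensor_dot ::
  "('v::real_vector \<Rightarrow> 'v \<Rightarrow> real) \<Rightarrow> ('v \<Rightarrow> 'v \<Rightarrow> complex) \<Rightarrow> ('v \<Rightarrow> 'v \<Rightarrow> complex) \<Rightarrow>
    ('v \<Rightarrow> 'v \<Rightarrow> complex)" where
  "tensor_dot g A B = (\<lambda>x y. contract g (\<lambda>a a'. A x a * B a' y))"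

definition tensor_prod ::
  "('v \<Rightarrow> 'v \<Rightarrow> complex) \<Rightarrow> ('v \<Rightarrow> 'v \<Rightarrow> complex) \<Rightarrow> ('v \<Rightarrow> 'v \<Rightarrow> 'v \<Rightarrow> 'v \<Rightarrow> complex)"
  (infixr "\<otimes>\<^sub>T" 75) where
  "A \<otimes>\<^sub>T B = (\<lambda>x y z w. A x y * B z w)"

definition tensor_cnj :: "('v \<Rightarrow> 'v \<Rightarrow> complex) \<Rightarrow> ('v \<Rightarrow> 'v \<Rightarrow> complex)" where
  "tensor_cnj A = (\<lambda>x y. cnj (A x y))"

definition dual2 ::
  "('v::real_vector \<Rightarrow> 'v \<Rightarrow> real) \<Rightarrow> ('v \<Rightarrow> 'v \<Rightarrow> 'v \<Rightarrow> 'v \<Rightarrow> real) \<Rightarrow>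
    ('v \<Rightarrow> 'v \<Rightarrow> complex) \<Rightarrow> ('v \<Rightarrow> 'v \<Rightarrow> complex)" where
  "dual2 g \<eta> F = (\<lambda>x y.
     (1/2) * contract g (\<lambda>a a'. contract g (\<lambda>b b'. of_real (\<eta> x y a b) * F a' b')))"

definition self_dual_bivector ::
  "('v::real_vector \<Rightarrow> 'v \<Rightarrow> real) \<Rightarrow> ('v \<Rightarrow> 'v \<Rightarrow> 'v \<Rightarrow> 'v \<Rightarrow> real) \<Rightarrow>
    ('v \<Rightarrow> 'v \<Rightarrow> complex) \<Rightarrow> bool" where
  "self_dual_bivector g \<eta> F \<longleftrightarrow>
     bilinear F \<and> (\<forall>x y. F y x = - F x y) \<and> (\<forall>x y. dual2 g \<eta> F x y = \<i> * F x y)"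

definition bivector_metric ::
  "('v::real_vector \<Rightarrow> 'v \<Rightarrow> real) \<Rightarrow> ('v \<Rightarrow> 'v \<Rightarrow> complex) \<Rightarrow> ('v \<Rightarrow> 'v \<Rightarrow> complex) \<Rightarrow> complex" where
  "bivector_metric g F H =
     (1/2) * contract g (\<lambda>a a'. contract g (\<lambda>b b'. F a b * H a' b'))"

text \<open>
  The self-dual bivectors form a complex three-dimensional space, so three orthonormal ones
  automatically form a basis of it.
\<close>

definition orthonormal_sd_frame ::
  "('v::real_vector \<Rightarrow> 'v \<Rightarrow> real) \<Rightarrow> ('v \<Rightarrow> 'v \<Rightarrow> 'v \<Rightarrow> 'v \<Rightarrow> real) \<Rightarrow>
    (3 \<Rightarrow> 'v \<Rightarrow> 'v \<Rightarrow> complex) \<Rightarrow> bool" where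
  "orthonormal_sd_frame g \<eta> U \<longleftrightarrow>
     (\<forall>i. self_dual_bivector g \<eta> (U i)) \<and>
     (\<forall>i j. bivector_metric g (U i) (U j) = - (if i = j then 1 else 0))"

section \<open>Weyl tensors\<close>

definition weyl_tensor ::
  "('v::real_vector \<Rightarrow> 'v \<Rightarrow> real) \<Rightarrow> ('v \<Rightarrow> 'v \<Rightarrow> 'v \<Rightarrow> 'v \<Rightarrow> real) \<Rightarrow> bool" where
  "weyl_tensor g W \<longleftrightarrow>
     multilinear4 W \<and>
     (\<forall>x y z w. W y x z w = - W x y z w) \<and>
     (\<forall>x y z w. W x y w z = - W x y z w) \<and>
     (\<forall>x y z w. W z w x y = W x y z w) \<and>
     (\<forall>x y z w. W x y z w + W x z w y + W x w y z = 0) \<and>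
     (\<forall>y w. contract g (\<lambda>a a'. W a y a' w) = 0)"

definition dual4 ::
  "('v::real_vector \<Rightarrow> 'v \<Rightarrow> real) \<Rightarrow> ('v \<Rightarrow> 'v \<Rightarrow> 'v \<Rightarrow> 'v \<Rightarrow> real) \<Rightarrow>
    ('v \<Rightarrow> 'v \<Rightarrow> 'v \<Rightarrow> 'v \<Rightarrow> real) \<Rightarrow> ('v \<Rightarrow> 'v \<Rightarrow> 'v \<Rightarrow> 'v \<Rightarrow> real)" where
  "dual4 g \<eta> W = (\<lambda>x y z w.
     (1/2) * contract g (\<lambda>a a'. contract g (\<lambda>b b'. \<eta> x y a b * W a' b' z w)))"

definition sd_weyl ::
  "('v::real_vector \<Rightarrow> 'v \<Rightarrow> real) \<Rightarrow> ('v \<Rightarrow> 'v \<Rightarrow> 'v \<Rightarrow> 'v \<Rightarrow> real) \<Rightarrow>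
    ('v \<Rightarrow> 'v \<Rightarrow> 'v \<Rightarrow> 'v \<Rightarrow> real) \<Rightarrow> ('v \<Rightarrow> 'v \<Rightarrow> 'v \<Rightarrow> 'v \<Rightarrow> complex)" where
  "sd_weyl g \<eta> W = (\<lambda>x y z w.
     (1/2) * (of_real (W x y z w) - \<i> * of_real (dual4 g \<eta> W x y z w)))"

definition sd_weyl_map ::
  "('v::real_vector \<Rightarrow> 'v \<Rightarrow> real) \<Rightarrow> ('v \<Rightarrow> 'v \<Rightarrow> 'v \<Rightarrow> 'v \<Rightarrow> real) \<Rightarrow>
    ('v \<Rightarrow> 'v \<Rightarrow> 'v \<Rightarrow> 'v \<Rightarrow> real) \<Rightarrow> ('v \<Rightarrow> 'v \<Rightarrow> complex) \<Rightarrow> ('v \<Rightarrow> 'v \<Rightarrow> complex)" where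
  "sd_weyl_map g \<eta> W F = (\<lambda>x y.
     (1/2) * contract g (\<lambda>a a'. contract g (\<lambda>b b'. sd_weyl g \<eta> W x y a b * F a' b')))"

definition weyl_eigenbivector ::
  "('v::real_vector \<Rightarrow> 'v \<Rightarrow> real) \<Rightarrow> ('v \<Rightarrow> 'v \<Rightarrow> 'v \<Rightarrow> 'v \<Rightarrow> real) \<Rightarrow>
    ('v \<Rightarrow> 'v \<Rightarrow> 'v \<Rightarrow> 'v \<Rightarrow> real) \<Rightarrow> complex \<Rightarrow> ('v \<Rightarrow> 'v \<Rightarrow> complex) \<Rightarrow> bool" where
  "weyl_eigenbivector g \<eta> W r F \<longleftrightarrow>
     self_dual_bivector g \<eta> F \<and> (\<exists>x y. F x y \<noteq> 0) \<and>
     (\<forall>x y. sd_weyl_map g \<eta> W F x y = r * F x y)"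

definition weyl_eigenvalues ::
  "('v::real_vector \<Rightarrow> 'v \<Rightarrow> real) \<Rightarrow> ('v \<Rightarrow> 'v \<Rightarrow> 'v \<Rightarrow> 'v \<Rightarrow> real) \<Rightarrow>
    ('v \<Rightarrow> 'v \<Rightarrow> 'v \<Rightarrow> 'v \<Rightarrow> real) \<Rightarrow> complex set" where
  "weyl_eigenvalues g \<eta> W = {r. \<exists>F. weyl_eigenbivector g \<eta> W r F}"

definition petrov_type_I ::
  "('v::real_vector \<Rightarrow> 'v \<Rightarrow> real) \<Rightarrow> ('v \<Rightarrow> 'v \<Rightarrow> 'v \<Rightarrow> 'v \<Rightarrow> real) \<Rightarrow>
    ('v \<Rightarrow> 'v \<Rightarrow> 'v \<Rightarrow> 'v \<Rightarrow> real) \<Rightarrow> bool" where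
  "petrov_type_I g \<eta> W \<longleftrightarrow> card (weyl_eigenvalues g \<eta> W) = 3"

section \<open>The Bel-Robinson tensor\<close>

definition bel_robinson ::
  "('v::real_vector \<Rightarrow> 'v \<Rightarrow> real) \<Rightarrow> ('v \<Rightarrow> 'v \<Rightarrow> 'v \<Rightarrow> 'v \<Rightarrow> real) \<Rightarrow>
    ('v \<Rightarrow> 'v \<Rightarrow> 'v \<Rightarrow> 'v \<Rightarrow> real) \<Rightarrow> ('v \<Rightarrow> 'v \<Rightarrow> 'v \<Rightarrow> 'v \<Rightarrow> complex)" where
  "bel_robinson g \<eta> W = (\<lambda>x m y n.
     contract g (\<lambda>a a'. contract g (\<lambda>b b'.
       sd_weyl g \<eta> W x a y b * cnj (sd_weyl g \<eta> W m a' n b'))))"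

definition tensor_map ::
  "('v::real_vector \<Rightarrow> 'v \<Rightarrow> real) \<Rightarrow> ('v \<Rightarrow> 'v \<Rightarrow> 'v \<Rightarrow> 'v \<Rightarrow> complex) \<Rightarrow>
    ('v \<Rightarrow> 'v \<Rightarrow> complex) \<Rightarrow> ('v \<Rightarrow> 'v \<Rightarrow> complex)" where
  "tensor_map g T A = (\<lambda>x y. contract g (\<lambda>a a'. contract g (\<lambda>b b'. T x y a b * A a' b')))"

definition eigentensor ::
  "('v::real_vector \<Rightarrow> 'v \<Rightarrow> real) \<Rightarrow> ('v \<Rightarrow> 'v \<Rightarrow> 'v \<Rightarrow> 'v \<Rightarrow> complex) \<Rightarrow>
    complex \<Rightarrow> ('v \<Rightarrow> 'v \<Rightarrow> complex) \<Rightarrow> bool" where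
  "eigentensor g T r A \<longleftrightarrow>
     bilinear A \<and> (\<forall>x y. A y x = A x y) \<and> contract g A = 0 \<and> (\<exists>x y. A x y \<noteq> 0) \<and>
     (\<forall>x y. tensor_map g T A x y = r * A x y)"

definition even_triples :: "(3 \<times> 3 \<times> 3) set" where
  "even_triples = {(p 1, p 2, p 3) |p. p permutes UNIV \<and> evenperm p}"

lemma even_triples_eq: "even_triples = {(1, 2, 3), (2, 3, 1), (3, 1, 2)}"
proof -
  let ?t = "Transposition.transpose :: 3 \<Rightarrow> 3 \<Rightarrow> 3 \<Rightarrow> 3"
  have eq: "p = q" if "p 1 = q 1" "p 2 = q 2" "p 3 = q 3" for p q :: "3 \<Rightarrow> 3"
    using that exhaust_3 by (intro ext) metis
  have odd: "\<not> evenperm (?t a b)" if "a \<noteq> b" for a b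
    using that by (simp add: evenperm_swap)
  have even: "evenperm (?t a b \<circ> ?t c d)" if "a \<noteq> b" "c \<noteq> d" for a b c d
    using that by (simp add: evenperm_comp evenperm_swap permutation_swap_id)
  show ?thesis
  proof (intro equalityI subsetI)
    fix x assume "x \<in> even_triples"
    then obtain p where x: "x = (p 1, p 2, p 3)" and p: "p permutes UNIV" and ev: "evenperm p"
      by (auto simp: even_triples_def)
    have "inj p" using p by (simp add: permutes_inj)
    then have ne: "p 1 \<noteq> p 2" "p 1 \<noteq> p 3" "p 2 \<noteq> p 3"
      by (simp_all add: inj_eq)
    have "\<not> (p 1 = 1 \<and> p 2 = 3 \<and> p 3 = 2)"
      using ev odd[of 2 3] eq[of p "?t 2 3"] by (auto simp: Transposition.transpose_def)
    moreover have "\<not> (p 1 = 2 \<and> p 2 = 1 \<and> p 3 = 3)"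
      using ev odd[of 1 2] eq[of p "?t 1 2"] by (auto simp: Transposition.transpose_def)
    moreover have "\<not> (p 1 = 3 \<and> p 2 = 2 \<and> p 3 = 1)"
      using ev odd[of 1 3] eq[of p "?t 1 3"] by (auto simp: Transposition.transpose_def)
    ultimately show "x \<in> {(1, 2, 3), (2, 3, 1), (3, 1, 2)}"
      unfolding x using ne exhaust_3[of "p 1"] exhaust_3[of "p 2"] exhaust_3[of "p 3"]
      by (elim disjE; simp)
  next
    have mem: "(p 1, p 2, p 3) \<in> even_triples" if "p permutes UNIV" "evenperm p" for p
      using that by (auto simp: even_triples_def)
    have mem2: "((?t a b \<circ> ?t c d) 1, (?t a b \<circ> ?t c d) 2, (?t a b \<circ> ?t c d) 3) \<in> even_triples"
      if "a \<noteq> b" "c \<noteq> d" for a b c d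
      by (intro mem even that permutes_compose permutes_swap_id) simp_all
    have "(1, 2, 3) \<in> even_triples"
      using mem[OF permutes_id] by simp
    moreover have "(2, 3, 1) \<in> even_triples"
      using mem2[of 1 2 2 3] by (simp add: Transposition.transpose_def)
    moreover have "(3, 1, 2) \<in> even_triples"
      using mem2[of 2 3 1 2] by (simp add: Transposition.transpose_def)
    ultimately show "x \<in> even_triples" if "x \<in> {(1, 2, 3), (2, 3, 1), (3, 1, 2)}" for x
      using that by auto
  qed
qed

end

theory Submission
  imports Defs
begin

text \<open>
  In an oriented orthonormal basis a self-dual bivector is determined by its three electric components
  \<open>F (e 0) (e k)\<close>, since \<open>F (e 2) (e 3) = \<i> * F (e 0) (e 1)\<close> and cyclically.  An orthonormal frame
  \<open>U\<close> therefore satisfies \<open>F = - (\<Sum>i. \<G>(F, U i) U i)\<close> for every self-dual \<open>F\<close>.  For fixed last two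
  arguments the tensor \<open>\<W>\<close> is a self-dual bivector, and tracelessness of \<open>W\<close> makes \<open>\<W>\<close> symmetric
  under exchange of its two pairs of arguments; so the coefficients of \<open>\<W>\<close> in the frame are the
  values \<open>\<W>(U i) = \<rho> i U i\<close>, which gives the expression of \<open>\<W>\<close>.  Substituting it into the definition of
  the Bel-Robinson tensor yields \<open>T = (\<Sum>i k. \<rho> i cnj(\<rho> k) P i k \<otimes> P i k)\<close> with
  \<open>P i k = U i \<cdot> cnj(U k)\<close>.  Since \<open>\<langle>A \<cdot> cnj B, A' \<cdot> cnj B'\<rangle> = \<G>(A, A') cnj(\<G>(B, B'))\<close>, the tensors
  \<open>P i k\<close> are orthonormal, and hence eigentensors.
\<close>

section \<open>Index sums, bilinear maps and double contractions\<close>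

text \<open>The numerals 4 and 0 denote the same element of the index type \<open>4\<close>. Listing
  from 0 makes the timelike index appear under the name used in the volume element.\<close>

lemma sum_4_from_0: "(\<Sum>i\<in>UNIV. f i) = f (0::4) + f 1 + f 2 + f 3"
proof -
  have "(4::4) = 0" by simp
  then show ?thesis unfolding sum_4 by (simp only: add_ac)
qed

lemma all_4_from_0: "(\<forall>i. P (i::4)) \<longleftrightarrow> P 0 \<and> P 1 \<and> P 2 \<and> P 3"
proof -
  have "(4::4) = 0" by simp
  then show ?thesis unfolding forall_4 by (simp only: conj_ac)
qed

lemma bilinear_mult_scale:
  fixes A :: "'v::real_vector \<Rightarrow> 'v \<Rightarrow> 'a::real_algebra"
  assumes "bilinear A" shows "bilinear (\<lambda>x y. c * A x y)"
  using assms
  by (auto simp: bilinear_def linear_iff algebra_simps)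

lemma bilinear_sum:
  assumes "\<And>i. bilinear (A i)" shows "bilinear (\<lambda>x y. \<Sum>i\<in>I. A i x y)"
  using assms
  by (auto simp: bilinear_def linear_iff sum.distrib scaleR_sum_right)

lemma bilinear_scaleR:
  assumes "bilinear A" shows "bilinear (\<lambda>x y. c *\<^sub>R A x y)"
  using assms
  by (auto simp: bilinear_def linear_iff algebra_simps)

lemma bilinear_add: "bilinear A \<Longrightarrow> bilinear B \<Longrightarrow> bilinear (\<lambda>x y. A x y + B x y)"
  by (auto simp: bilinear_def linear_iff algebra_simps)

lemma bilinear_of_real:
  assumes "bilinear A" shows "bilinear (\<lambda>x y. complex_of_real (A x y))"
  using assms
  by (auto simp: bilinear_def linear_iff scaleR_conv_of_real)

lemma bilinear_tensor_cnj:
  assumes "bilinear A" shows "bilinear (tensor_cnj A)"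
  using assms
  by (auto simp: bilinear_def linear_iff tensor_cnj_def)

lemma multilinear4_bilinear:
  assumes "multilinear4 S"
  shows "bilinear (\<lambda>x y. S x y z w)" "bilinear (S x y)" "bilinear (\<lambda>x z. S x y z w)"
  using assms by (auto simp: bilinear_def multilinear4_def)

text \<open>Bilinearity allows \<open>contract_eq\<close> to be used twice, first for the inner
  contraction at fixed \<open>a\<close> and \<open>a'\<close>, then for the resulting sum. Every
  contraction can thus be computed in one prescribed basis instead of the one chosen inside
  \<open>contract\<close>.\<close>

lemma contract_mult_eq:
  fixes K H :: "'v::real_vector \<Rightarrow> 'v \<Rightarrow> 'a::real_algebra"
  assumes g: "lorentzian_metric g" and e: "orthonormal_basis g e"
    and K: "bilinear K" and H: "bilinear H"
  shows "contract g (\<lambda>a a'. contract g (\<lambda>b b'. K a b * H a' b')) =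
    (\<Sum>i\<in>UNIV. \<Sum>j\<in>UNIV. (lorentz_sign i * lorentz_sign j) *\<^sub>R (K (e i) (e j) * H (e i) (e j)))"
proof -
  have inner: "contract g (\<lambda>b b'. K a b * H a' b') =
      (\<Sum>j\<in>UNIV. lorentz_sign j *\<^sub>R (K a (e j) * H a' (e j)))" for a a'
    by (intro contract_eq[OF g _ e]) (use K H in \<open>auto simp: bilinear_def linear_iff algebra_simps\<close>)
  have "bilinear (\<lambda>a a'. \<Sum>j\<in>UNIV. lorentz_sign j *\<^sub>R (K a (e j) * H a' (e j)))"
    by (intro bilinear_sum bilinear_scaleR) (use K H in \<open>auto simp: bilinear_def linear_iff algebra_simps\<close>)
  then show ?thesis
    unfolding inner by (subst contract_eq[OF g _ e]) (simp_all add: scaleR_sum_right)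
qed

lemma bilinear_eq_frame:
  assumes "span (range e) = UNIV" "bilinear A" "bilinear B" "\<And>i j. A (e i) (e j) = B (e i) (e j)"
  shows "A x y = B x y"
  by (rule bilinear_eq[OF assms(2,3), of UNIV "range e" UNIV "range e"]) (use assms in auto)

section \<open>Components in a positively oriented orthonormal basis\<close>

locale oriented_frame =
  fixes g :: "'v::real_vector \<Rightarrow> 'v \<Rightarrow> real" and \<eta> :: "'v \<Rightarrow> 'v \<Rightarrow> 'v \<Rightarrow> 'v \<Rightarrow> real"
    and e :: "4 \<Rightarrow> 'v"
  assumes lorentzian: "lorentzian_metric g"
    and basis: "orthonormal_basis g e"
    and multilinear_vol: "multilinear4 \<eta>"
    and vol_alternating: "\<eta> y x z w = - \<eta> x y z w" "\<eta> x z y w = - \<eta> x y z w"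
      "\<eta> x y w z = - \<eta> x y z w"
    and vol_frame: "\<eta> (e 0) (e 1) (e 2) (e 3) = 1"
begin

lemma span_frame: "span (range e) = UNIV"
  using basis by (simp add: orthonormal_basis_def)

lemma sign_simps: "lorentz_sign 0 = -1" "lorentz_sign 1 = 1" "lorentz_sign 2 = 1" "lorentz_sign 3 = 1"
  by (simp_all add: lorentz_sign_def)

lemma vol_repeated: "\<eta> x x z w = 0" "\<eta> x y y w = 0" "\<eta> x y z z = 0"
   "\<eta> x y x w = 0" "\<eta> x y z y = 0" "\<eta> x y z x = 0"
proof -
  show 1: "\<eta> x x z w = 0" and 2: "\<eta> x y y w = 0" and "\<eta> x y z z = 0" for x y z w
    using vol_alternating(1)[of x x z w] vol_alternating(2)[of x y y w] vol_alternating(3)[of x y z z]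
    by simp_all
  show 3: "\<eta> x y x w = 0" and "\<eta> x y z y = 0" for x y z w
    using vol_alternating(2)[of x y x w] 1[of x y w] vol_alternating(3)[of x y y z] 2[of x y z] by simp_all
  then show "\<eta> x y z x = 0"
    using vol_alternating(3)[of x y x z] 3[of x y z] by simp
qed

text \<open>Together with \<open>vol_repeated\<close> these 24 permutation signs evaluate the volume
  element on all basis vectors, so that simplification never has to reorder its arguments.\<close>

lemma vol_sorted:
  "\<eta> (e 0) (e 1) (e 2) (e 3) = 1"
  "\<eta> (e 0) (e 1) (e 3) (e 2) = -1"
  "\<eta> (e 0) (e 2) (e 1) (e 3) = -1"
  "\<eta> (e 0) (e 2) (e 3) (e 1) = 1"
  "\<eta> (e 0) (e 3) (e 1) (e 2) = 1"
  "\<eta> (e 0) (e 3) (e 2) (e 1) = -1"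
  "\<eta> (e 1) (e 0) (e 2) (e 3) = -1"
  "\<eta> (e 1) (e 0) (e 3) (e 2) = 1"
  "\<eta> (e 1) (e 2) (e 0) (e 3) = 1"
  "\<eta> (e 1) (e 2) (e 3) (e 0) = -1"
  "\<eta> (e 1) (e 3) (e 0) (e 2) = -1"
  "\<eta> (e 1) (e 3) (e 2) (e 0) = 1"
  "\<eta> (e 2) (e 0) (e 1) (e 3) = 1"
  "\<eta> (e 2) (e 0) (e 3) (e 1) = -1"
  "\<eta> (e 2) (e 1) (e 0) (e 3) = -1"
  "\<eta> (e 2) (e 1) (e 3) (e 0) = 1"
  "\<eta> (e 2) (e 3) (e 0) (e 1) = 1"
  "\<eta> (e 2) (e 3) (e 1) (e 0) = -1"
  "\<eta> (e 3) (e 0) (e 1) (e 2) = -1"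
  "\<eta> (e 3) (e 0) (e 2) (e 1) = 1"
  "\<eta> (e 3) (e 1) (e 0) (e 2) = 1"
  "\<eta> (e 3) (e 1) (e 2) (e 0) = -1"
  "\<eta> (e 3) (e 2) (e 0) (e 1) = -1"
  "\<eta> (e 3) (e 2) (e 1) (e 0) = 1"
  using vol_frame vol_alternating by metis+

lemmas vol_simps = vol_sorted vol_repeated

text \<open>The last premise uses object-level quantifiers so that \<open>all_4_from_0\<close> can
  expand it into sixteen component equations.\<close>

lemma frame_eqI:
  assumes "bilinear A" "bilinear B" "\<forall>i j. A (e i) (e j) = B (e i) (e j)"
  shows "A x y = B x y"
  by (rule bilinear_eq_frame[OF span_frame assms(1,2)]) (use assms(3) in blast)

text \<open>The independent components are taken to be 01, 02, 03 (electric) and 23, 31, 12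
  (magnetic). With this cyclic choice duality pairs them without permutation signs, and the rules,
  read from left to right, bring every component to this form.\<close>

lemma antisymmetric_frame:
  fixes F :: "'v \<Rightarrow> 'v \<Rightarrow> 'a::real_vector"
  assumes "\<And>x y. F y x = - F x y"
  shows "F x x = 0"
    "F (e 1) (e 0) = - F (e 0) (e 1)" "F (e 2) (e 0) = - F (e 0) (e 2)" "F (e 3) (e 0) = - F (e 0) (e 3)"
    "F (e 3) (e 2) = - F (e 2) (e 3)" "F (e 1) (e 3) = - F (e 3) (e 1)" "F (e 2) (e 1) = - F (e 1) (e 2)"
proof -
  have "F x x = - F x x" by (rule assms)
  then have "2 *\<^sub>R F x x = 0" by (simp add: scaleR_2 eq_neg_iff_add_eq_0)
  then show "F x x = 0" by simp
qed (rule assms)+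

section \<open>The Hodge dual of a bivector\<close>

lemma dual2_frame:
  assumes "bilinear F"
  shows "dual2 g \<eta> F x y = (1/2) * (\<Sum>i\<in>UNIV. \<Sum>j\<in>UNIV.
    (lorentz_sign i * lorentz_sign j) *\<^sub>R (of_real (\<eta> x y (e i) (e j)) * F (e i) (e j)))"
  unfolding dual2_def
  by (subst contract_mult_eq[OF lorentzian basis bilinear_of_real assms])
    (auto intro: multilinear4_bilinear multilinear_vol)

lemma bilinear_vol: "bilinear (\<lambda>x y. \<eta> x y z w)" "bilinear (\<eta> x y)"
  by (auto intro: multilinear4_bilinear multilinear_vol)

lemma bilinear_dual2:
  assumes "bilinear F" shows "bilinear (dual2 g \<eta> F)"
proof -
  have "dual2 g \<eta> F = (\<lambda>x y. (1/2) * (\<Sum>i\<in>UNIV. \<Sum>j\<in>UNIV.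
    (lorentz_sign i * lorentz_sign j) *\<^sub>R (F (e i) (e j) * of_real (\<eta> x y (e i) (e j)))))"
    by (intro ext) (simp add: dual2_frame[OF assms] mult.commute)
  moreover have "bilinear \<dots>"
    by (intro bilinear_mult_scale bilinear_sum bilinear_scaleR bilinear_of_real bilinear_vol)
  ultimately show ?thesis by simp
qed

text \<open>Each component receives two equal terms, which absorb the factor 1/2. The minus signs
  come from raising one timelike index; they express that the dual squares to -1.\<close>

lemma dual2_components:
  assumes F: "bilinear F" and anti: "\<And>x y. F y x = - F x y"
  shows "dual2 g \<eta> F (e 0) (e 1) = F (e 2) (e 3)" "dual2 g \<eta> F (e 0) (e 2) = F (e 3) (e 1)"
    "dual2 g \<eta> F (e 0) (e 3) = F (e 1) (e 2)" "dual2 g \<eta> F (e 2) (e 3) = - F (e 0) (e 1)"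
    "dual2 g \<eta> F (e 3) (e 1) = - F (e 0) (e 2)" "dual2 g \<eta> F (e 1) (e 2) = - F (e 0) (e 3)"
  by (simp_all add: dual2_frame[OF F] sum_4_from_0 sign_simps vol_simps antisymmetric_frame[of F, OF anti])

lemma dual2_antisymmetric:
  assumes F: "bilinear F"
  shows "dual2 g \<eta> F y x = - dual2 g \<eta> F x y"
  by (simp add: dual2_frame[OF F] vol_alternating(1)[of x y] sum_negf)

lemma bivector_eqI:
  fixes A B :: "'v \<Rightarrow> 'v \<Rightarrow> complex"
  assumes "bilinear A" "bilinear B" "\<And>x y. A y x = - A x y" "\<And>x y. B y x = - B x y"
   "A (e 0) (e 1) = B (e 0) (e 1)" "A (e 0) (e 2) = B (e 0) (e 2)" "A (e 0) (e 3) = B (e 0) (e 3)"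
   "A (e 2) (e 3) = B (e 2) (e 3)" "A (e 3) (e 1) = B (e 3) (e 1)" "A (e 1) (e 2) = B (e 1) (e 2)"
  shows "A x y = B x y"
  by (rule frame_eqI[OF assms(1,2)])
     (use assms(5-) in \<open>simp add: all_4_from_0 antisymmetric_frame[of A, OF assms(3)] antisymmetric_frame[of B, OF assms(4)]\<close>)

section \<open>Self-dual bivectors and their orthonormal frames\<close>

lemma self_dual_components:
  assumes "self_dual_bivector g \<eta> F"
  shows "F (e 2) (e 3) = \<i> * F (e 0) (e 1)" "F (e 3) (e 1) = \<i> * F (e 0) (e 2)"
    "F (e 1) (e 2) = \<i> * F (e 0) (e 3)"
  using dual2_components(1-3)[of F] assms unfolding self_dual_bivector_def by metis+

lemma bivector_metric_frame:
  assumes "bilinear F" "bilinear H"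
  shows "bivector_metric g F H = (1/2) * (\<Sum>i\<in>UNIV. \<Sum>j\<in>UNIV.
    (lorentz_sign i * lorentz_sign j) *\<^sub>R (F (e i) (e j) * H (e i) (e j)))"
  unfolding bivector_metric_def by (subst contract_mult_eq[OF lorentzian basis assms]) simp

text \<open>The electric components contribute minus their scalar product. The magnetic ones
  contribute with a plus sign, but they are \<i> times the electric ones, so they give the same
  amount again.\<close>

lemma bivector_metric_self_dual:
  assumes F: "self_dual_bivector g \<eta> F" and H: "self_dual_bivector g \<eta> H"
  shows "bivector_metric g F H = - 2 * (F (e 0) (e 1) * H (e 0) (e 1)
    + F (e 0) (e 2) * H (e 0) (e 2) + F (e 0) (e 3) * H (e 0) (e 3))"
proof -
  have "bilinear F" "bilinear H" and anti: "\<And>x y. F y x = - F x y" "\<And>x y. H y x = - H x y"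
    using F H unfolding self_dual_bivector_def by blast+
  from this(1,2) show ?thesis
    by (simp add: bivector_metric_frame sum_4_from_0 sign_simps antisymmetric_frame[of F, OF anti(1)]
      antisymmetric_frame[of H, OF anti(2)] self_dual_components[OF F] self_dual_components[OF H] field_simps)
qed

lemma self_dualD:
  assumes "self_dual_bivector g \<eta> F"
  shows "bilinear F" "F y x = - F x y"
  using assms unfolding self_dual_bivector_def by blast+

lemma orthonormal_sd_frame_self_dual:
  "orthonormal_sd_frame g \<eta> U \<Longrightarrow> self_dual_bivector g \<eta> (U i)"
  by (simp add: orthonormal_sd_frame_def)

text \<open>
  The electric components of an orthonormal frame form a matrix that is orthogonal up to a scalar;
  its columns are then orthonormal as well, and this is what makes the frame a basis.
\<close>

lemma orthonormal_sd_frame_complete: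
  assumes U: "orthonormal_sd_frame g \<eta> U" and k: "k \<in> {1, 2, 3}" and l: "l \<in> {1, 2, 3}"
  shows "(\<Sum>i\<in>UNIV. U i (e 0) (e k) * U i (e 0) (e l)) = (if k = l then 1/2 else 0)"
proof -
  \<comment> \<open>Both indices of a square matrix must have the same type; \<open>c\<close>
    translates the type \<open>3\<close> into the spatial indices of type \<open>4\<close>. The
    factor 2 of the metric is put into \<open>B\<close>.\<close>
  define c :: "3 \<Rightarrow> 4" where "c m = (if m = 1 then 1 else if m = 2 then 2 else 3)" for m
  define A :: "complex^3^3" where "A = (\<chi> i m. U i (e 0) (e (c m)))"
  define B :: "complex^3^3" where "B = (\<chi> m i. 2 * U i (e 0) (e (c m)))"
  have "bivector_metric g (U i) (U j) = - (if i = j then 1 else 0)" for i j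
    using U by (simp add: orthonormal_sd_frame_def)
  then have orth: "2 * (U i (e 0) (e 1) * U j (e 0) (e 1) + U i (e 0) (e 2) * U j (e 0) (e 2)
     + U i (e 0) (e 3) * U j (e 0) (e 3)) = (if i = j then 1 else 0)" for i j
    unfolding bivector_metric_self_dual[OF orthonormal_sd_frame_self_dual[OF U] orthonormal_sd_frame_self_dual[OF U]]
    by (simp only: mult_minus_left neg_equal_iff_equal)
  have "(A ** B) $ i $ j = (mat 1 :: complex^3^3) $ i $ j" for i j
  proof -
    have "(A ** B) $ i $ j = 2 * (U i (e 0) (e 1) * U j (e 0) (e 1)
       + U i (e 0) (e 2) * U j (e 0) (e 2) + U i (e 0) (e 3) * U j (e 0) (e 3))"
      by (simp add: A_def B_def matrix_matrix_mult_def sum_3 c_def)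
    then show ?thesis
      unfolding orth by (simp add: mat_def)
  qed
  then have "A ** B = mat 1"
    by (simp add: vec_eq_iff)
  \<comment> \<open>A one-sided inverse of a square matrix is two-sided: orthonormality of the rows
    becomes orthonormality of the columns.\<close>
  then have "B ** A = mat 1"
    by (simp add: matrix_left_right_inverse)
  then have "(\<Sum>i\<in>UNIV. 2 * U i (e 0) (e (c m)) * U i (e 0) (e (c n))) = (if m = n then 1 else 0)" for m n
    by (simp add: A_def B_def matrix_matrix_mult_def mat_def vec_eq_iff)
  then have *: "2 * (\<Sum>i\<in>UNIV. U i (e 0) (e (c m)) * U i (e 0) (e (c n))) = (if m = n then 1 else 0)" for m n
    by (simp add: sum_distrib_left mult.assoc)
  have half: "(\<Sum>i\<in>UNIV. U i (e 0) (e (c m)) * U i (e 0) (e (c n))) = (if m = n then 1/2 else 0)" for m n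
  proof -
    have "S = r / 2" if "2 * S = r" for S r :: complex using that[symmetric] by simp
    from this[OF *[of m n]] show ?thesis by (simp only: if_distrib[of "\<lambda>x. x / 2"] div_0)
  qed
  have "\<exists>m. c m = k" "\<exists>n. c n = l"
    using k l by (auto simp: c_def split: if_splits intro: exI[of _ 1] exI[of _ 2] exI[of _ 3])
  moreover have "inj c"
    using exhaust_3 by (auto simp: inj_def c_def split: if_splits)
  ultimately show ?thesis
    using half by (auto simp: inj_eq)
qed

text \<open>The electric components agree by completeness of the frame, where the 2 of the metric
  cancels the 1/2 of the completeness relation. Self-duality of both sides then determines the
  magnetic components.\<close>

lemma self_dual_expansion:
  assumes U: "orthonormal_sd_frame g \<eta> U" and F: "self_dual_bivector g \<eta> F"
  shows "F x y = - (\<Sum>i\<in>UNIV. bivector_metric g F (U i) * U i x y)"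
proof -
  note sdU = orthonormal_sd_frame_self_dual[OF U]
  let ?S = "\<lambda>x y. - (\<Sum>i\<in>UNIV. bivector_metric g F (U i) * U i x y)"
  have E: "?S (e 0) (e k) = F (e 0) (e k)" if k: "k \<in> {1, 2, 3}" for k
  proof -
    have "?S (e 0) (e k) =
       2 * (F (e 0) (e 1) * (\<Sum>i\<in>UNIV. U i (e 0) (e 1) * U i (e 0) (e k))
          + F (e 0) (e 2) * (\<Sum>i\<in>UNIV. U i (e 0) (e 2) * U i (e 0) (e k))
          + F (e 0) (e 3) * (\<Sum>i\<in>UNIV. U i (e 0) (e 3) * U i (e 0) (e k)))"
      by (simp add: bivector_metric_self_dual[OF F sdU] sum_3 algebra_simps)
    then show ?thesis
      using k by (auto simp: orthonormal_sd_frame_complete[OF U])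
  qed
  have B: "?S (e 2) (e 3) = \<i> * ?S (e 0) (e 1)" "?S (e 3) (e 1) = \<i> * ?S (e 0) (e 2)"
     "?S (e 1) (e 2) = \<i> * ?S (e 0) (e 3)"
    by (simp_all add: self_dual_components[OF sdU] sum_3 algebra_simps)
  have "F x y = ?S x y"
  proof (rule bivector_eqI)
    show "bilinear F" by (rule self_dualD[OF F])
    show "bilinear ?S"
      using bilinear_mult_scale[OF bilinear_sum[OF bilinear_mult_scale[OF self_dualD(1)[OF sdU]]], of "-1"]
      by simp
    show "F y x = - F x y" for x y by (rule self_dualD[OF F])
    show "?S y x = - ?S x y" for x y
      by (subst self_dualD(2)[OF sdU]) (simp add: sum_negf)
  qed (simp_all only: B E self_dual_components[OF F] insert_iff simp_thms)
  then show ?thesis .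
qed

text \<open>Since the dual squares to -1 on bivectors, the dual of C - \<i> *C is *C + \<i> C, which
  is \<i> (C - \<i> *C).\<close>

lemma self_dual_part:
  assumes C: "bilinear C" and anti: "\<And>x y. C y x = - C x y"
    and F: "\<And>x y. F x y = (1/2) * (C x y - \<i> * dual2 g \<eta> C x y)"
  shows "self_dual_bivector g \<eta> F"
proof -
  have "F = (\<lambda>x y. (1/2) * (C x y + - \<i> * dual2 g \<eta> C x y))"
    by (intro ext) (simp add: F)
  then have bil: "bilinear F"
    by (simp only: bilinear_mult_scale bilinear_add C bilinear_dual2)
  have antiF: "F y x = - F x y" for x y
    unfolding F by (subst anti, subst dual2_antisymmetric[OF C]) (simp add: field_simps)
  have "dual2 g \<eta> F x y = \<i> * F x y" for x y
  proof (rule bivector_eqI)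
    show "bilinear (\<lambda>x y. \<i> * F x y)"
      by (rule bilinear_mult_scale[OF bil])
    show "\<i> * F y x = - (\<i> * F x y)" for x y
      by (subst antiF) simp
    show "dual2 g \<eta> F y x = - dual2 g \<eta> F x y" for x y
      by (rule dual2_antisymmetric[OF bil])
  qed (simp_all only: bil bilinear_dual2 dual2_components[OF bil antiF],
      simp_all add: F dual2_components[OF C anti] field_simps)
  then show ?thesis
    unfolding self_dual_bivector_def using bil antiF by blast
qed

lemma dual4_eq_dual2:
  assumes W: "multilinear4 W"
  shows "of_real (dual4 g \<eta> W x y z w) = dual2 g \<eta> (\<lambda>x y. of_real (W x y z w)) x y"
proof -
  have *: "dual4 g \<eta> W x y z w = (1/2) * (\<Sum>i\<in>UNIV. \<Sum>j\<in>UNIV.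
    (lorentz_sign i * lorentz_sign j) *\<^sub>R (\<eta> x y (e i) (e j) * W (e i) (e j) z w))"
    unfolding dual4_def
    by (subst contract_mult_eq[OF lorentzian basis bilinear_vol(2) multilinear4_bilinear(1)[OF W]]) simp
  show ?thesis
    unfolding * dual2_frame[OF bilinear_of_real[OF multilinear4_bilinear(1)[OF W]]]
    by (simp add: scaleR_conv_of_real)
qed

section \<open>Products of a self-dual bivector with a conjugate one\<close>

lemma tensor_cnj_apply: "tensor_cnj A x y = cnj (A x y)"
  by (simp add: tensor_cnj_def)

lemma tensor_dot_frame:
  assumes A: "bilinear A" and B: "bilinear B"
  shows "tensor_dot g A B x y = (\<Sum>i\<in>UNIV. lorentz_sign i *\<^sub>R (A x (e i) * B (e i) y))"
proof -
  have "bilinear (\<lambda>a a'. A x a * B a' y)"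
    using A B by (auto simp: bilinear_def linear_iff algebra_simps)
  from contract_eq[OF lorentzian this basis] show ?thesis
    by (simp add: tensor_dot_def)
qed

lemma bilinear_tensor_dot:
  assumes A: "bilinear A" and B: "bilinear B"
  shows "bilinear (tensor_dot g A B)"
proof -
  have "bilinear (\<lambda>x y. A x a * B b y)" for a b
    using A B by (auto simp: bilinear_def linear_iff algebra_simps)
  then have "bilinear (\<lambda>x y. \<Sum>i\<in>UNIV. lorentz_sign i *\<^sub>R (A x (e i) * B (e i) y))"
    by (intro bilinear_sum bilinear_scaleR)
  also have "(\<lambda>x y. \<Sum>i\<in>UNIV. lorentz_sign i *\<^sub>R (A x (e i) * B (e i) y)) = tensor_dot g A B"
    by (intro ext) (simp add: tensor_dot_frame[OF A B])
  finally show ?thesis .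
qed

context
  fixes A B
  assumes A: "self_dual_bivector g \<eta> A" and B: "self_dual_bivector g \<eta> B"
begin

lemmas sd_bilinear = self_dualD(1)[OF A] self_dualD(1)[OF B] bilinear_tensor_cnj[OF self_dualD(1)[OF A]]
  bilinear_tensor_cnj[OF self_dualD(1)[OF B]]
lemmas sd_components_AB = antisymmetric_frame[of A, OF self_dualD(2)[OF A]] antisymmetric_frame[of B, OF self_dualD(2)[OF B]]
  self_dual_components[OF A] self_dual_components[OF B]

text \<open>These rules reduce the components of both mixed products to polynomials in the electric
  components of \<open>A\<close> and \<open>B\<close> and their conjugates.\<close>

lemmas dot_frame = tensor_dot_frame[OF sd_bilinear(1,4)] tensor_dot_frame[OF sd_bilinear(2,3)]
   tensor_cnj_apply sum_4_from_0 sign_simps sd_components_AB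

text \<open>Transposition reverses the order of the two factors, the signs of two antisymmetric
  tensors cancelling, and a self-dual bivector commutes with an anti-self-dual one.\<close>

lemma self_dual_dot_sym:
  "tensor_dot g A (tensor_cnj B) y x = tensor_dot g A (tensor_cnj B) x y"
proof -
  have "bilinear (tensor_dot g A (tensor_cnj B))" (is "bilinear ?P")
    by (intro bilinear_tensor_dot sd_bilinear)
  then have "bilinear (\<lambda>x y. ?P y x)" "bilinear ?P" by (simp_all add: bilinear_def)
  then show ?thesis
    by (rule frame_eqI) (simp add: all_4_from_0 dot_frame algebra_simps)
qed

lemma self_dual_dot_cnj:
  "tensor_dot g A (tensor_cnj B) = tensor_cnj (tensor_dot g B (tensor_cnj A))"
proof (intro ext)
  fix x y
  have "bilinear (tensor_dot g A (tensor_cnj B))" "bilinear (tensor_cnj (tensor_dot g B (tensor_cnj A)))"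
    by (intro bilinear_tensor_dot bilinear_tensor_cnj sd_bilinear)+
  then show "tensor_dot g A (tensor_cnj B) x y = tensor_cnj (tensor_dot g B (tensor_cnj A)) x y"
    by (rule frame_eqI) (simp add: all_4_from_0 dot_frame algebra_simps)
qed

text \<open>The trace is, up to a factor, the metric product of a self-dual and an anti-self-dual
  bivector; there the electric and magnetic contributions cancel.\<close>

lemma self_dual_dot_traceless: "contract g (tensor_dot g A (tensor_cnj B)) = 0"
proof -
  have "bilinear (tensor_dot g A (tensor_cnj B))"
    by (intro bilinear_tensor_dot sd_bilinear)
  from contract_eq[OF lorentzian this basis] show ?thesis
    by (simp add: dot_frame algebra_simps)
qed

end

text \<open>In spinor terms \<open>A\<close> carries a symmetric unprimed spinor and the conjugate
  of \<open>B\<close> a symmetric primed one, and the dot product is their outer product up to a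
  constant. Its inner products therefore factorize.\<close>

lemma self_dual_dot_inner:
  assumes A: "self_dual_bivector g \<eta> A" and B: "self_dual_bivector g \<eta> B"
    and A': "self_dual_bivector g \<eta> A'" and B': "self_dual_bivector g \<eta> B'"
  shows "(\<Sum>i\<in>UNIV. \<Sum>j\<in>UNIV. (lorentz_sign i * lorentz_sign j) *\<^sub>R
      (tensor_dot g A (tensor_cnj B) (e i) (e j) * tensor_dot g A' (tensor_cnj B') (e i) (e j)))
    = bivector_metric g A A' * cnj (bivector_metric g B B')"
proof -
  obtain a1 a2 a3 where a: "A (e 0) (e 1) = a1" "A (e 0) (e 2) = a2" "A (e 0) (e 3) = a3" by blast
  \<comment> \<open>Only conjugates of \<open>B\<close> and \<open>B'\<close> enter, so their
    components are named as conjugates. All conjugations then vanish and a polynomial identity in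
    twelve variables remains.\<close>
  obtain b1 b2 b3 where b: "B (e 0) (e 1) = cnj b1" "B (e 0) (e 2) = cnj b2" "B (e 0) (e 3) = cnj b3"
    by (metis complex_cnj_cnj)
  obtain c1 c2 c3 where c: "A' (e 0) (e 1) = c1" "A' (e 0) (e 2) = c2" "A' (e 0) (e 3) = c3" by blast
  obtain d1 d2 d3 where d: "B' (e 0) (e 1) = cnj d1" "B' (e 0) (e 2) = cnj d2" "B' (e 0) (e 3) = cnj d3"
    by (metis complex_cnj_cnj)
  show ?thesis
    unfolding bivector_metric_self_dual[OF A A'] bivector_metric_self_dual[OF B B']
    by (simp add: sum_4_from_0 sign_simps dot_frame[OF A B] dot_frame[OF A' B'] a b c d) (simp add: algebra_simps)
qed

end

section \<open>The self-dual part of a Weyl tensor\<close>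

locale weyl_frame = oriented_frame g \<eta> e
  for g :: "'v::real_vector \<Rightarrow> 'v \<Rightarrow> real" and \<eta> e +
  fixes W :: "'v \<Rightarrow> 'v \<Rightarrow> 'v \<Rightarrow> 'v \<Rightarrow> real"
  assumes weyl: "weyl_tensor g W"
begin

lemma W_multilinear: "multilinear4 W"
  and W_anti1: "W y x z w = - W x y z w"
  and W_anti2: "W x y w z = - W x y z w"
  and W_pair: "W z w x y = W x y z w"
  and W_trace: "contract g (\<lambda>a a'. W a y a' w) = 0"
  using weyl unfolding weyl_tensor_def by blast+

lemma W_trace_frame: "- W (e 0) y (e 0) w + W (e 1) y (e 1) w + W (e 2) y (e 2) w + W (e 3) y (e 3) w = 0"
proof -
  have "bilinear (\<lambda>a a'. W a y a' w)"
    by (rule multilinear4_bilinear(3)[OF W_multilinear])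
  from contract_eq[OF lorentzian this basis] W_trace[of y w] show ?thesis
    by (simp add: sum_4_from_0 sign_simps)
qed

lemmas W_sort = antisymmetric_frame[of "\<lambda>x y. W x y z w" for z w, OF W_anti1]
   antisymmetric_frame[of "W x y" for x y, OF W_anti2]

text \<open>
  These relations, all consequences of the vanishing trace, say that the left and the right dual of
  \<open>W\<close> coincide.
\<close>

lemma W_electric_magnetic:
  "W (e 2) (e 3) (e 0) (e 2) = W (e 3) (e 1) (e 0) (e 1)"
  "W (e 2) (e 3) (e 0) (e 3) = W (e 1) (e 2) (e 0) (e 1)"
  "W (e 3) (e 1) (e 0) (e 3) = W (e 1) (e 2) (e 0) (e 2)"
  "W (e 2) (e 3) (e 2) (e 3) = - W (e 0) (e 1) (e 0) (e 1)"
  "W (e 3) (e 1) (e 3) (e 1) = - W (e 0) (e 2) (e 0) (e 2)"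
  "W (e 1) (e 2) (e 1) (e 2) = - W (e 0) (e 3) (e 0) (e 3)"
  "W (e 2) (e 3) (e 3) (e 1) = - W (e 0) (e 1) (e 0) (e 2)"
  "W (e 2) (e 3) (e 1) (e 2) = - W (e 0) (e 1) (e 0) (e 3)"
  "W (e 3) (e 1) (e 1) (e 2) = - W (e 0) (e 2) (e 0) (e 3)"
  using W_trace_frame[of "e 0" "e 0"] W_trace_frame[of "e 0" "e 1"] W_trace_frame[of "e 0" "e 2"]
    W_trace_frame[of "e 0" "e 3"] W_trace_frame[of "e 1" "e 1"] W_trace_frame[of "e 1" "e 2"]
    W_trace_frame[of "e 1" "e 3"] W_trace_frame[of "e 2" "e 2"] W_trace_frame[of "e 2" "e 3"]
    W_trace_frame[of "e 3" "e 3"]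
    W_pair[of "e 0" "e 1" "e 0" "e 2"] W_pair[of "e 0" "e 1" "e 0" "e 3"] W_pair[of "e 0" "e 2" "e 0" "e 3"]
    W_pair[of "e 0" "e 1" "e 2" "e 3"] W_pair[of "e 0" "e 1" "e 3" "e 1"] W_pair[of "e 0" "e 1" "e 1" "e 2"]
    W_pair[of "e 0" "e 2" "e 2" "e 3"] W_pair[of "e 0" "e 2" "e 3" "e 1"] W_pair[of "e 0" "e 2" "e 1" "e 2"]
    W_pair[of "e 0" "e 3" "e 2" "e 3"] W_pair[of "e 0" "e 3" "e 3" "e 1"] W_pair[of "e 0" "e 3" "e 1" "e 2"]
    W_pair[of "e 2" "e 3" "e 3" "e 1"] W_pair[of "e 2" "e 3" "e 1" "e 2"] W_pair[of "e 3" "e 1" "e 1" "e 2"]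
  by (simp_all add: W_sort)

text \<open>A complex copy of \<open>W\<close>, to which \<open>dual2\<close> and the results on
  complex bivectors apply.\<close>

definition Wc :: "'v \<Rightarrow> 'v \<Rightarrow> 'v \<Rightarrow> 'v \<Rightarrow> complex" where
  "Wc x y z w = of_real (W x y z w)"

lemma Wc_bilinear: "bilinear (\<lambda>x y. Wc x y z w)" "bilinear (Wc x y)"
  unfolding Wc_def
  by (intro bilinear_of_real multilinear4_bilinear W_multilinear)+

lemma Wc_anti: "Wc y x z w = - Wc x y z w" "Wc x y w z = - Wc x y z w"
  unfolding Wc_def by (subst W_anti1 W_anti2, simp)+

lemma Wc_pair: "Wc z w x y = Wc x y z w"
  unfolding Wc_def by (subst W_pair) simp

lemmas Wc_electric_magnetic = W_electric_magnetic[THEN arg_cong[where f = complex_of_real],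
  unfolded of_real_minus, folded Wc_def]

lemma sd_weyl_eq: "sd_weyl g \<eta> W x y z w = (1/2) * (Wc x y z w - \<i> * dual2 g \<eta> (\<lambda>x y. Wc x y z w) x y)"
  by (simp add: sd_weyl_def dual4_eq_dual2[OF W_multilinear] Wc_def)

lemma self_dual_sd_weyl: "self_dual_bivector g \<eta> (\<lambda>x y. sd_weyl g \<eta> W x y z w)"
  by (rule self_dual_part[OF Wc_bilinear(1) Wc_anti(1)]) (rule sd_weyl_eq)

lemmas dual_Wc = dual2_components[OF Wc_bilinear(1) Wc_anti(1)]

lemma bilinear_dual_Wc: "bilinear (\<lambda>z w. dual2 g \<eta> (\<lambda>x y. Wc x y z w) x y)"
  unfolding dual2_frame[OF Wc_bilinear(1)]
  by (intro bilinear_mult_scale bilinear_sum bilinear_scaleR Wc_bilinear)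

lemma dual_Wc_anti: "dual2 g \<eta> (\<lambda>x y. Wc x y w z) x y = - dual2 g \<eta> (\<lambda>x y. Wc x y z w) x y"
  unfolding dual2_frame[OF Wc_bilinear(1)]
  by (subst Wc_anti) (simp add: sum_negf)

text \<open>By pair symmetry of \<open>W\<close> the right-hand side is the dual taken on the second
  pair, so this is the coincidence of left and right dual. It is what makes the self-dual part
  symmetric under exchange of pairs.\<close>

lemma dual_Wc_pair: "dual2 g \<eta> (\<lambda>x y. Wc x y z w) x y = dual2 g \<eta> (\<lambda>z w. Wc z w x y) z w"
proof -
  define D where "D x y z w = dual2 g \<eta> (\<lambda>x y. Wc x y z w) x y" for x y z w
  have bil: "bilinear (\<lambda>x y. D x y z w)" "bilinear (D x y)" for x y z w
    unfolding D_def by (rule bilinear_dual2[OF Wc_bilinear(1)], rule bilinear_dual_Wc)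
  have anti: "D y x z w = - D x y z w" "D x y w z = - D x y z w" for x y z w
    unfolding D_def by (rule dual2_antisymmetric[OF Wc_bilinear(1)], rule dual_Wc_anti)
  note comp = dual_Wc[folded D_def] Wc_electric_magnetic
    Wc_pair[of "e 0" "e 1" "e 2" "e 3"] Wc_pair[of "e 0" "e 1" "e 3" "e 1"] Wc_pair[of "e 0" "e 1" "e 1" "e 2"]
    Wc_pair[of "e 0" "e 2" "e 2" "e 3"] Wc_pair[of "e 0" "e 2" "e 3" "e 1"] Wc_pair[of "e 0" "e 2" "e 1" "e 2"]
    Wc_pair[of "e 0" "e 3" "e 2" "e 3"] Wc_pair[of "e 0" "e 3" "e 3" "e 1"] Wc_pair[of "e 0" "e 3" "e 1" "e 2"]
    Wc_pair[of "e 0" "e 2" "e 0" "e 1"] Wc_pair[of "e 0" "e 3" "e 0" "e 1"] Wc_pair[of "e 0" "e 3" "e 0" "e 2"]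
    Wc_pair[of "e 3" "e 1" "e 2" "e 3"] Wc_pair[of "e 1" "e 2" "e 2" "e 3"] Wc_pair[of "e 1" "e 2" "e 3" "e 1"]
  \<comment> \<open>The comparison is made one pair at a time: here the second pair is a basis pair
    and the first is arbitrary; the next step frees the second pair as well.\<close>
  have frame: "D x y (e k) (e l) = D (e k) (e l) x y"
    if "(k, l) \<in> {(0,1), (0,2), (0,3), (2,3), (3,1), (1,2)}" for k l x y
    by (rule bivector_eqI[of "\<lambda>x y. D x y (e k) (e l)" "D (e k) (e l)", OF bil anti])
      (use that in \<open>auto simp: comp\<close>)
  have "D x y z w = D z w x y"
    by (rule bivector_eqI[of "D x y" "\<lambda>z w. D z w x y", OF bil(2,1) anti(2,1)])
      (rule frame; simp)+
  then show ?thesis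
    by (simp only: D_def)
qed

lemma sd_weyl_pair: "sd_weyl g \<eta> W z w x y = sd_weyl g \<eta> W x y z w"
  unfolding sd_weyl_eq by (subst Wc_pair, subst dual_Wc_pair) simp

lemma sd_weyl_expansion:
  assumes U: "orthonormal_sd_frame g \<eta> U" and eig: "\<And>i. weyl_eigenbivector g \<eta> W (\<rho> i) (U i)"
  shows "sd_weyl g \<eta> W x y z w = - (\<Sum>i\<in>UNIV. \<rho> i * (U i x y * U i z w))"
proof -
  \<comment> \<open>The metric product contracts the first pair, the Weyl map the second one; pair
    symmetry identifies them.\<close>
  have "bivector_metric g (\<lambda>x y. sd_weyl g \<eta> W x y z w) (U i) = sd_weyl_map g \<eta> W (U i) z w" for i
    unfolding bivector_metric_def sd_weyl_map_def by (subst sd_weyl_pair) (rule refl)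
  also have "\<dots> i = \<rho> i * U i z w" for i
    using eig by (simp add: weyl_eigenbivector_def)
  finally show ?thesis
    by (subst self_dual_expansion[OF U self_dual_sd_weyl]) (simp add: mult_ac)
qed

section \<open>The Bel-Robinson tensor and its eigentensors\<close>

context
  fixes \<rho> U
  assumes U: "orthonormal_sd_frame g \<eta> U" and eig: "\<And>i. weyl_eigenbivector g \<eta> W (\<rho> i) (U i)"
begin

abbreviation P where "P i k \<equiv> tensor_dot g (U i) (tensor_cnj (U k))"

lemmas sdU = orthonormal_sd_frame_self_dual[OF U]

text \<open>The contracted index is moved to the last slot of the second factor, which is where the
  Bel-Robinson contraction has it; antisymmetry costs a sign.\<close>

lemma P_frame: "P i k x y = - (\<Sum>a\<in>UNIV. lorentz_sign a *\<^sub>R (U i x (e a) * cnj (U k y (e a))))"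
proof -
  have "cnj (U k (e a) y) = - cnj (U k y (e a))" for a
    by (subst self_dualD(2)[OF sdU]) simp
  then show ?thesis
    by (simp add: tensor_dot_frame[OF self_dualD(1)[OF sdU] bilinear_tensor_cnj[OF self_dualD(1)[OF sdU]]]
        tensor_cnj_apply sum_negf)
qed

lemma bilinear_P: "bilinear (P i k)"
  by (intro bilinear_tensor_dot bilinear_tensor_cnj self_dualD(1) sdU)

lemma bel_robinson_expansion:
  "bel_robinson g \<eta> W x m y n = (\<Sum>i\<in>UNIV. \<Sum>k\<in>UNIV. \<rho> i * cnj (\<rho> k) * (P i k x m * P i k y n))"
proof -
  note sd = sd_weyl_expansion[OF U eig]
  have bil: "bilinear (\<lambda>a b. sd_weyl g \<eta> W x a y b)" for x y
  proof -
    have "bilinear (\<lambda>a b. U i x a * U i y b)" for i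
      using self_dualD(1)[OF sdU[of i]] by (auto simp: bilinear_def linear_iff algebra_simps)
    then have "bilinear (\<lambda>a b. (-1) * (\<Sum>i\<in>UNIV. \<rho> i * (U i x a * U i y b)))"
      by (intro bilinear_mult_scale bilinear_sum)
    then show ?thesis by (simp add: sd)
  qed
  have bil_cnj: "bilinear (\<lambda>a b. cnj (sd_weyl g \<eta> W x a y b))" for x y
    using bilinear_tensor_cnj[OF bil] by (simp add: tensor_cnj_def)
  let ?s = "\<lambda>i. complex_of_real (lorentz_sign i)"
  have "bel_robinson g \<eta> W x m y n = (\<Sum>a\<in>UNIV. \<Sum>b\<in>UNIV. ?s a * ?s b *
      ((\<Sum>i\<in>UNIV. \<rho> i * (U i x (e a) * U i y (e b))) * (\<Sum>k\<in>UNIV. cnj (\<rho> k) * (cnj (U k m (e a)) * cnj (U k n (e b))))))"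
    unfolding bel_robinson_def contract_mult_eq[OF lorentzian basis bil bil_cnj]
    by (simp add: sd scaleR_conv_of_real)
  \<comment> \<open>The index \<open>a\<close> links only \<open>x\<close> with \<open>m\<close>,
    and \<open>b\<close> only \<open>y\<close> with \<open>n\<close>. Once the basis sums are
    innermost they separate into two factors of the form in \<open>P_frame\<close>, whose signs
    cancel.\<close>
  also have "\<dots> = (\<Sum>a\<in>UNIV. \<Sum>b\<in>UNIV. \<Sum>i\<in>UNIV. \<Sum>k\<in>UNIV. \<rho> i * cnj (\<rho> k) *
     ((?s a * (U i x (e a) * cnj (U k m (e a)))) * (?s b * (U i y (e b) * cnj (U k n (e b))))))"
    by (simp only: sum_product) (simp only: sum_distrib_left mult_ac)
  also have "\<dots> = (\<Sum>i\<in>UNIV. \<Sum>k\<in>UNIV. \<Sum>a\<in>UNIV. \<Sum>b\<in>UNIV. \<rho> i * cnj (\<rho> k) *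
     ((?s a * (U i x (e a) * cnj (U k m (e a)))) * (?s b * (U i y (e b) * cnj (U k n (e b))))))"
    by (simp only: sum.cartesian_product)
      (rule sum.reindex_bij_witness[where i = "\<lambda>(i, k, a, b). (a, b, i, k)" and j = "\<lambda>(a, b, i, k). (i, k, a, b)"]; auto)
  also have "\<dots> = (\<Sum>i\<in>UNIV. \<Sum>k\<in>UNIV. \<rho> i * cnj (\<rho> k) * (P i k x m * P i k y n))"
    unfolding P_frame minus_mult_minus scaleR_conv_of_real
    by (simp only: sum_product) (simp only: sum_distrib_left)
  finally show ?thesis .
qed

text \<open>The two signs of the frame normalization multiply to +1. The pairing is complex
  bilinear, without conjugation, as is the contraction in \<open>tensor_map\<close>.\<close>

lemma P_inner: "(\<Sum>a\<in>UNIV. \<Sum>b\<in>UNIV. (lorentz_sign a * lorentz_sign b) *\<^sub>R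
      (P i k (e a) (e b) * P j l (e a) (e b))) = (if i = j \<and> k = l then 1 else 0)"
  unfolding self_dual_dot_inner[OF sdU sdU sdU sdU]
  using U by (simp add: orthonormal_sd_frame_def)

lemma P_nonzero: "\<exists>x y. P i k x y \<noteq> 0"
proof (rule ccontr)
  assume "\<not> ?thesis"
  then have "P i k x y = 0" for x y by blast
  then show False using P_inner[of i k i k] by simp
qed

lemma bel_robinson_P: "tensor_map g (bel_robinson g \<eta> W) (P j l) x y = \<rho> j * cnj (\<rho> l) * P j l x y"
proof -
  have bil: "bilinear (bel_robinson g \<eta> W x y)"
  proof -
    have "bilinear (\<lambda>z w. \<Sum>i\<in>UNIV. \<Sum>k\<in>UNIV. \<rho> i * cnj (\<rho> k) * (P i k x y * P i k z w))"
      by (intro bilinear_sum bilinear_mult_scale bilinear_P)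
    then show ?thesis by (simp add: bel_robinson_expansion[abs_def])
  qed
  have "tensor_map g (bel_robinson g \<eta> W) (P j l) x y = (\<Sum>a\<in>UNIV. \<Sum>b\<in>UNIV. (lorentz_sign a * lorentz_sign b) *\<^sub>R
     (\<Sum>i\<in>UNIV. \<Sum>k\<in>UNIV. \<rho> i * cnj (\<rho> k) * (P i k x y * P i k (e a) (e b)) * P j l (e a) (e b)))"
    unfolding tensor_map_def contract_mult_eq[OF lorentzian basis bil bilinear_P]
    by (simp add: bel_robinson_expansion sum_distrib_right)
  also have "\<dots> = (\<Sum>a\<in>UNIV. \<Sum>b\<in>UNIV. \<Sum>i\<in>UNIV. \<Sum>k\<in>UNIV. \<rho> i * cnj (\<rho> k) * P i k x y *
     ((lorentz_sign a * lorentz_sign b) *\<^sub>R (P i k (e a) (e b) * P j l (e a) (e b))))"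
    by (simp add: scaleR_sum_right mult.assoc)
  also have "\<dots> = (\<Sum>i\<in>UNIV. \<Sum>k\<in>UNIV. \<Sum>a\<in>UNIV. \<Sum>b\<in>UNIV. \<rho> i * cnj (\<rho> k) * P i k x y *
     ((lorentz_sign a * lorentz_sign b) *\<^sub>R (P i k (e a) (e b) * P j l (e a) (e b))))"
    by (simp only: sum.cartesian_product)
      (rule sum.reindex_bij_witness[where i = "\<lambda>(i, k, a, b). (a, b, i, k)" and j = "\<lambda>(a, b, i, k). (i, k, a, b)"]; auto)
  \<comment> \<open>With the basis sums innermost, orthonormality leaves only the term i = j, k =
    l.\<close>
  also have "\<dots> = (\<Sum>i\<in>UNIV. \<Sum>k\<in>UNIV. if i = j \<and> k = l then \<rho> i * cnj (\<rho> k) * P i k x y else 0)"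
    unfolding sum_distrib_left[symmetric] P_inner by (intro sum.cong) auto
  also have "\<dots> = \<rho> j * cnj (\<rho> l) * P j l x y"
  proof -
    have "(\<Sum>k\<in>UNIV. if i = j \<and> k = l then \<rho> i * cnj (\<rho> k) * P i k x y else 0)
        = (if i = j then \<rho> i * cnj (\<rho> l) * P i l x y else 0)" for i
      by (cases "i = j") simp_all
    then show ?thesis by simp
  qed
  finally show ?thesis .
qed

lemma eigentensor_P: "eigentensor g (bel_robinson g \<eta> W) (\<rho> j * cnj (\<rho> l)) (P j l)"
  unfolding eigentensor_def
  by (auto intro: bilinear_P self_dual_dot_sym[OF sdU sdU] self_dual_dot_traceless[OF sdU sdU] P_nonzero bel_robinson_P)

end

end

section \<open>The canonical expression\<close>

lemma volume_element_obtain_frame: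
  assumes "lorentzian_metric g" "volume_element g \<eta>"
  obtains e where "oriented_frame g \<eta> e"
  using assms unfolding volume_element_def oriented_frame_def by blast

theorem proposition3:
  fixes g :: "'v::real_vector \<Rightarrow> 'v \<Rightarrow> real"
    and \<eta> W :: "'v \<Rightarrow> 'v \<Rightarrow> 'v \<Rightarrow> 'v \<Rightarrow> real"
    and \<rho> \<tau> :: "3 \<Rightarrow> complex" and t :: "3 \<Rightarrow> real"
    and U :: "3 \<Rightarrow> 'v \<Rightarrow> 'v \<Rightarrow> complex"
    and P :: "3 \<Rightarrow> 3 \<Rightarrow> 'v \<Rightarrow> 'v \<Rightarrow> complex"
  assumes "dim (UNIV :: 'v set) = 4"
    and "lorentzian_metric g"
    and "volume_element g \<eta>"
    and "weyl_tensor g W"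
    and "petrov_type_I g \<eta> W"
    and "weyl_eigenvalues g \<eta> W = range \<rho>"
    and "orthonormal_sd_frame g \<eta> U"
    and "\<And>i. weyl_eigenbivector g \<eta> W (\<rho> i) (U i)"
    and "\<And>i. t i = (cmod (\<rho> i))\<^sup>2"
    and "\<And>i j k. (i, j, k) \<in> even_triples \<Longrightarrow> \<tau> i = \<rho> j * cnj (\<rho> k)"
    and "\<And>j k. P j k = tensor_dot g (U j) (tensor_cnj (U k))"
  shows "(\<forall>x y z w. sd_weyl g \<eta> W x y z w = - (\<Sum>i\<in>UNIV. \<rho> i * (U i \<otimes>\<^sub>T U i) x y z w)) \<and>
    (\<forall>x y z w. bel_robinson g \<eta> W x y z w =
         (\<Sum>i\<in>UNIV. complex_of_real (t i) * (P i i \<otimes>\<^sub>T P i i) x y z w)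
       + (\<Sum>(i, j, k)\<in>even_triples. \<tau> i * (P j k \<otimes>\<^sub>T P j k) x y z w)
       + (\<Sum>(i, j, k)\<in>even_triples. cnj (\<tau> i) * (P k j \<otimes>\<^sub>T P k j) x y z w)) \<and>
    (\<forall>i. eigentensor g (bel_robinson g \<eta> W) (complex_of_real (t i)) (P i i)) \<and>
    (\<forall>(i, j, k)\<in>even_triples.
       eigentensor g (bel_robinson g \<eta> W) (\<tau> i) (P j k) \<and> P j k = tensor_cnj (P k j))"
proof -
  obtain e where "oriented_frame g \<eta> e"
    using volume_element_obtain_frame[OF assms(2,3)] .
  then interpret weyl_frame g \<eta> e W
    using assms(4) by (simp add: weyl_frame_def weyl_frame_axioms_def)
  note U = assms(7) and eig = assms(8) and P = assms(11)
  have t: "complex_of_real (t i) = \<rho> i * cnj (\<rho> i)" for i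
    by (simp only: assms(9) complex_norm_square)
  have \<tau>: "\<tau> 1 = \<rho> 2 * cnj (\<rho> 3)" "\<tau> 2 = \<rho> 3 * cnj (\<rho> 1)" "\<tau> 3 = \<rho> 1 * cnj (\<rho> 2)"
    by (rule assms(10); simp add: even_triples_eq)+
  have "sd_weyl g \<eta> W x y z w = - (\<Sum>i\<in>UNIV. \<rho> i * (U i \<otimes>\<^sub>T U i) x y z w)" for x y z w
    by (simp add: sd_weyl_expansion[OF U eig] tensor_prod_def)
  \<comment> \<open>The nine index pairs split into the diagonal, the cyclic pairs (j, k) and the
    reversed pairs (k, j). The last carry \<rho> k cnj(\<rho> j), the conjugate of \<tau> i.\<close>
  moreover have "bel_robinson g \<eta> W x y z w =
         (\<Sum>i\<in>UNIV. complex_of_real (t i) * (P i i \<otimes>\<^sub>T P i i) x y z w)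
       + (\<Sum>(i, j, k)\<in>even_triples. \<tau> i * (P j k \<otimes>\<^sub>T P j k) x y z w)
       + (\<Sum>(i, j, k)\<in>even_triples. cnj (\<tau> i) * (P k j \<otimes>\<^sub>T P k j) x y z w)" for x y z w
    by (simp add: bel_robinson_expansion[OF U eig] P[symmetric] tensor_prod_def even_triples_eq t \<tau> sum_3
        mult.commute[of "cnj _"] add_ac)
  moreover have "eigentensor g (bel_robinson g \<eta> W) (complex_of_real (t i)) (P i i)" for i
    unfolding t P by (rule eigentensor_P[OF U eig])
  moreover have "eigentensor g (bel_robinson g \<eta> W) (\<tau> i) (P j k)" if "(i, j, k) \<in> even_triples" for i j k
    unfolding assms(10)[OF that] P by (rule eigentensor_P[OF U eig])
  moreover have "P j k = tensor_cnj (P k j)" for j k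
    unfolding P by (rule self_dual_dot_cnj) (rule orthonormal_sd_frame_self_dual[OF U])+
  ultimately show ?thesis by blast
qed

end
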